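(* Let $G$ be a matching covered graph and let $C = \partial(X)$ be a separating cut of $G$. Then \[ \operatorname{pf}(G) \geq \max\{\operatorname{pf}(G/X), \operatorname{pf}(G/\overline{X})\}. \]
   Context: Graphs are finite; $G$ is simple, but contractions of $G$ may have multiple edges (perfect matchings are sets of edges, and all definitions below apply verbatim to loopless multigraphs). Given an orientation $D$ of a graph $G$ with vertices enumerated $1,\dots,2m$ and a perfect matching $M$ of $G$, $\operatorname{sign}_D(M)\in\{1,-1\}$ is the sign of the permutation $\begin{pmatrix}1&2&\cdots&2m-1&2m\\ u_1&v_1&\cdots&u_m&v_m\end{pmatrix}$, where the edges of $M$ are $u_iv_i$, oriented in $D$ from $u_i$ to $v_i$ (independent of the order in which the edges are listed). For a positive integer $k$, a $k$-orientation of $G$ is a vector $\mathbf{D}=(D_1,\dots,D_k)$ of orientations of $G$; for a perfect matching $M$, $\mathbf{sign}_{\mathbf{D}}(M) := (\operatorname{sign}_{D_1}(M),\dots,\operatorname{sign}_{D_k}(M))$, and the signature matrix $\mathbf{sign}_{\mathbf{D}}$ has these vectors as rows, one row for each perfect matching $M$ of $G$. $\mathbf{D}$ is pfaffian if $\mathbf{sign}_{\mathbf{D}}\,\mathbf{x}=\mathbf{1}$ has a solution $\mathbf{x}\in\mathbb{R}^k$. $G$ is $k$-pfaffian if it admits a pfaffian $k$-orientation (independent of the enumeration of the vertices). The pfaffian number $\operatorname{pf}(G)$ is the smallest positive integer $k$ such that $G$ is $k$-pfaffian (it always exists). A graph is matching covered if it is connected, has at least one edge, and every edge lies in some perfect matching.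 For a set $X$ of vertices, with $\overline{X}=V(G)\setminus X$, the cut $\partial(X)$ is the set of edges with one end in $X$ and the other in $\overline{X}$. $G/X$ is the graph obtained by contracting the vertices in $X$ to a single vertex and removing the resulting loops. The $C$-contractions of $G$, for $C=\partial(X)$, are $G/X$ and $G/\overline{X}$ (both $X$ and $\overline{X}$ nonempty). A cut $C$ of a matching covered graph is separating if both $C$-contractions are matching covered. *)

theory Defs
  imports Complex_Main "HOL-Combinatorics.Permutations"
begin

record ('v, 'e) mgraph =
  verts :: "'v set"
  edges :: "'e set"
  ends :: "'e \<Rightarrow> 'v set"

definition loopless_multigraph :: "('v, 'e) mgraph \<Rightarrow> bool" where
  "loopless_multigraph G \<longleftrightarrow> finite (verts G) \<and> finite (edges G) \<and>
     (\<forall>e\<in>edges G. ends G e \<subseteq> verts G \<and> card (ends G e) = 2)"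

definition simple_graph :: "('v, 'e) mgraph \<Rightarrow> bool" where
  "simple_graph G \<longleftrightarrow> loopless_multigraph G \<and> inj_on (ends G) (edges G)"

definition perfect_matching :: "('v, 'e) mgraph \<Rightarrow> 'e set \<Rightarrow> bool" where
  "perfect_matching G M \<longleftrightarrow> M \<subseteq> edges G \<and> (\<forall>v\<in>verts G. \<exists>!e. e \<in> M \<and> v \<in> ends G e)"

definition adjacency :: "('v, 'e) mgraph \<Rightarrow> ('v \<times> 'v) set" where
  "adjacency G = {(u, v). \<exists>e\<in>edges G. ends G e = {u, v}}"

definition connected_graph :: "('v, 'e) mgraph \<Rightarrow> bool" where
  "connected_graph G \<longleftrightarrow> verts G \<noteq> {} \<and> (\<forall>u\<in>verts G. \<forall>v\<in>verts G. (u, v) \<in> (adjacency G)\<^sup>*)"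

definition matching_covered :: "('v, 'e) mgraph \<Rightarrow> bool" where
  "matching_covered G \<longleftrightarrow> connected_graph G \<and> edges G \<noteq> {} \<and>
     (\<forall>e\<in>edges G. \<exists>M. perfect_matching G M \<and> e \<in> M)"

text \<open>The vertex obtained by contraction is \<open>None\<close>. Parallel edges are kept, and an edge
  becomes a loop, and is removed, exactly if both its ends lie in \<open>X\<close>.\<close>

definition contraction_map :: "'v set \<Rightarrow> 'v \<Rightarrow> 'v option" where
  "contraction_map X v = (if v \<in> X then None else Some v)"

definition contract :: "('v, 'e) mgraph \<Rightarrow> 'v set \<Rightarrow> ('v option, 'e) mgraph" where
  "contract G X =
     \<lparr>verts = contraction_map X ` verts G,
      edges = {e \<in> edges G. \<not> ends G e \<subseteq> X},
      ends = (\<lambda>e. contraction_map X ` ends G e)\<rparr>"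

definition cut :: "('v, 'e) mgraph \<Rightarrow> 'v set \<Rightarrow> 'e set" where
  "cut G X = {e \<in> edges G. ends G e \<inter> X \<noteq> {} \<and> ends G e \<inter> (verts G - X) \<noteq> {}}"

text \<open>In a connected graph a cut determines its shore up to complementation, so it does not
  matter which shore \<open>Y\<close> of \<open>C\<close> is used.\<close>

definition separating_cut :: "('v, 'e) mgraph \<Rightarrow> 'e set \<Rightarrow> bool" where
  "separating_cut G C \<longleftrightarrow>
     (\<exists>Y. Y \<subseteq> verts G \<and> Y \<noteq> {} \<and> verts G - Y \<noteq> {} \<and> C = cut G Y \<and>
          matching_covered (contract G Y) \<and> matching_covered (contract G (verts G - Y)))"

text \<open>An orientation maps each edge to the pair of its tail and its head.\<close>

definition orientation :: "('v, 'e) mgraph \<Rightarrow> ('e \<Rightarrow> 'v \<times> 'v) \<Rightarrow> bool" where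
  "orientation G D \<longleftrightarrow> (\<forall>e\<in>edges G. {fst (D e), snd (D e)} = ends G e)"

definition vertex_enumeration :: "('v, 'e) mgraph \<Rightarrow> ('v \<Rightarrow> nat) \<Rightarrow> bool" where
  "vertex_enumeration G num \<longleftrightarrow> bij_betw num (verts G) {1..card (verts G)}"

text \<open>For \<open>es = [e\<^sub>1, \<dots>, e\<^sub>m]\<close> the permutation sends \<open>2 * i - 1\<close> to the number of
  the tail of \<open>e\<^sub>i\<close> and \<open>2 * i\<close> to the number of its head; list positions start at 0.\<close>

definition matching_perm :: "('v \<Rightarrow> nat) \<Rightarrow> ('e \<Rightarrow> 'v \<times> 'v) \<Rightarrow> 'e list \<Rightarrow> nat \<Rightarrow> nat" where
  "matching_perm num D es j =
     (if j \<in> {1..2 * length es}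
      then num ((if odd j then fst else snd) (D (es ! ((j - 1) div 2))))
      else j)"

text \<open>For a perfect matching the sign does not depend on the chosen listing of its edges.\<close>

definition matching_sign :: "('v \<Rightarrow> nat) \<Rightarrow> ('e \<Rightarrow> 'v \<times> 'v) \<Rightarrow> 'e set \<Rightarrow> int" where
  "matching_sign num D M =
     sign (matching_perm num D (SOME es. distinct es \<and> set es = M))"

text \<open>A \<open>k\<close>-orientation is a family of orientations with index set \<open>{1..k}\<close>; the rows of its
  signature matrix are indexed by the perfect matchings \<open>M\<close>, the columns by \<open>i \<in> {1..k}\<close>.\<close>

definition k_orientation :: "('v, 'e) mgraph \<Rightarrow> nat \<Rightarrow> (nat \<Rightarrow> 'e \<Rightarrow> 'v \<times> 'v) \<Rightarrow> bool" where
  "k_orientation G k Ds \<longleftrightarrow> (\<forall>i\<in>{1..k}. orientation G (Ds i))"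

definition signature_matrix ::
    "('v \<Rightarrow> nat) \<Rightarrow> (nat \<Rightarrow> 'e \<Rightarrow> 'v \<times> 'v) \<Rightarrow> 'e set \<Rightarrow> nat \<Rightarrow> real" where
  "signature_matrix num Ds M i = real_of_int (matching_sign num (Ds i) M)"

definition pfaffian_k_orientation ::
    "('v, 'e) mgraph \<Rightarrow> ('v \<Rightarrow> nat) \<Rightarrow> nat \<Rightarrow> (nat \<Rightarrow> 'e \<Rightarrow> 'v \<times> 'v) \<Rightarrow> bool" where
  "pfaffian_k_orientation G num k Ds \<longleftrightarrow> k_orientation G k Ds \<and>
     (\<exists>x :: nat \<Rightarrow> real. \<forall>M. perfect_matching G M \<longrightarrow>
        (\<Sum>i = 1..k. signature_matrix num Ds M i * x i) = 1)"

text \<open>Renumbering the vertices multiplies all signs by a common factor, so it does not matter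
  which enumeration is used.\<close>

definition k_pfaffian :: "('v, 'e) mgraph \<Rightarrow> nat \<Rightarrow> bool" where
  "k_pfaffian G k \<longleftrightarrow>
     (\<exists>num. vertex_enumeration G num \<and> (\<exists>Ds. pfaffian_k_orientation G num k Ds))"

definition pf :: "('v, 'e) mgraph \<Rightarrow> nat" where
  "pf G = (LEAST k. 0 < k \<and> k_pfaffian G k)"

end

theory Submission
  imports Defs
begin

text \<open>
  Let \<open>H\<close> be the contraction of \<open>X\<close>. Every pfaffian \<open>k\<close>-orientation of \<open>G\<close> induces one of \<open>H\<close>,
  with the same solution vector. Indeed, a perfect matching \<open>M\<close> of \<open>H\<close> contains exactly one
  edge \<open>e\<close> of the cut, and since the other contraction is matching covered, a perfect matching
  \<open>N\<^sub>e\<close> of it that contains \<open>e\<close> can be fixed once and for all. Then \<open>M \<union> N\<^sub>e\<close> is a perfect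
  matching of \<open>G\<close> (\<open>matching_union\<close>), and for every orientation \<open>D\<close> of \<open>G\<close> the sign of
  \<open>M \<union> N\<^sub>e\<close> under \<open>D\<close> is the sign of \<open>M\<close> under the induced orientation of \<open>H\<close> times a factor
  that depends on \<open>D\<close> and \<open>e\<close> but not on \<open>M\<close> (\<open>matching_sign_contract_ratio\<close>). Reversing in
  \<open>H\<close> those cut edges \<open>e\<close> for which the factor is \<open>- 1\<close> makes the two signs equal, so each row
  of the signature matrix of \<open>H\<close> is a row of that of \<open>G\<close> (\<open>k_pfaffian_contract\<close>).

  To pass to pfaffian numbers, \<open>G\<close> must be \<open>k\<close>-pfaffian for some positive \<open>k\<close>, as otherwise
  \<^term>\<open>pf G\<close> would be an unspecified number. The family of all reversals of one orientation
  is pfaffian, by orthogonality of characters (\<open>k_pfaffian_exists\<close>).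
\<close>

section \<open>Signs of perfect matchings\<close>

text \<open>The vertex at position \<open>j\<close> of the word tail, head, tail, head, ... of the listed
  edges; positions start at 1.\<close>

definition matching_word :: "('e \<Rightarrow> 'v \<times> 'v) \<Rightarrow> 'e list \<Rightarrow> nat \<Rightarrow> 'v" where
  "matching_word D es j = (if odd j then fst else snd) (D (es ! ((j - 1) div 2)))"

lemma matching_perm_word:
  "matching_perm num D es j =
     (if j \<in> {1..2 * length es} then num (matching_word D es j) else j)"
  by (simp add: matching_perm_def matching_word_def)

lemma position_cases:
  assumes "j \<in> {1..2 * m}"
  obtains (tail) i where "i < m" "j = Suc (2 * i)"
        | (head) i where "i < m" "j = Suc (Suc (2 * i))"
proof (cases "odd j")
  case True
  then obtain i where "j = Suc (2 * i)" by (metis oddE Suc_eq_plus1)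
  then show ?thesis using assms tail[of i] by auto
next
  case False
  then obtain i where "j = 2 * i" by blast
  then show ?thesis using assms head[of "i - 1"] by (cases i) auto
qed

lemma matching_word_tail: "matching_word D es (Suc (2 * i)) = fst (D (es ! i))"
  and matching_word_head: "matching_word D es (Suc (Suc (2 * i))) = snd (D (es ! i))"
  by (simp_all add: matching_word_def)

lemma matching_perm_tail:
  "i < length es \<Longrightarrow> matching_perm num D es (Suc (2 * i)) = num (fst (D (es ! i)))"
  and matching_perm_head:
  "i < length es \<Longrightarrow> matching_perm num D es (Suc (Suc (2 * i))) = num (snd (D (es ! i)))"
  by (auto simp: matching_perm_word matching_word_tail matching_word_head)

lemma matching_word_in_ends:
  assumes "orientation G D" "set es \<subseteq> edges G" "j \<in> {1..2 * length es}"
  shows "(j - 1) div 2 < length es"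
    and "matching_word D es j \<in> ends G (es ! ((j - 1) div 2))"
proof -
  show l: "(j - 1) div 2 < length es"
    using assms(3) by auto
  then have "es ! ((j - 1) div 2) \<in> edges G"
    using assms(2) by auto
  then show "matching_word D es j \<in> ends G (es ! ((j - 1) div 2))"
    using assms(1) unfolding orientation_def matching_word_def by auto
qed

lemma matching_word_bij:
  assumes G: "loopless_multigraph G" and M: "perfect_matching G M" and D: "orientation G D"
    and es: "distinct es" "set es = M"
  shows "bij_betw (matching_word D es) {1..2 * length es} (verts G)"
proof -
  have sub: "set es \<subseteq> edges G"
    using M es(2) unfolding perfect_matching_def by simp
  note ends = matching_word_in_ends[OF D sub]
  have ne: "fst (D e) \<noteq> snd (D e)" if "e \<in> M" for e
  proof
    assume "fst (D e) = snd (D e)"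
    moreover have e: "e \<in> edges G" using that es sub by auto
    ultimately have "ends G e = {fst (D e)}"
      using D unfolding orientation_def by force
    then show False
      using G e unfolding loopless_multigraph_def by force
  qed
  have vs: "matching_word D es j \<in> verts G" if "j \<in> {1..2 * length es}" for j
    using ends[OF that] sub G unfolding loopless_multigraph_def
    by (meson nth_mem subsetD)
  have inj: "inj_on (matching_word D es) {1..2 * length es}"
  proof
    fix j j' assume j: "j \<in> {1..2 * length es}" and j': "j' \<in> {1..2 * length es}"
      and eq: "matching_word D es j = matching_word D es j'"
    have "es ! ((j - 1) div 2) = es ! ((j' - 1) div 2)"
      using ends[OF j] ends[OF j'] eq vs[OF j] M es(2) unfolding perfect_matching_def
      by (metis nth_mem)
    then have i: "(j - 1) div 2 = (j' - 1) div 2"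
      using ends(1)[OF j] ends(1)[OF j'] es(1) nth_eq_iff_index_eq by blast
    have "odd j \<longleftrightarrow> odd j'"
      using eq ne[of "es ! ((j - 1) div 2)"] ends(1)[OF j] es(2)
      unfolding matching_word_def i[symmetric] by (auto split: if_splits)
    then show "j = j'"
      using i j j' by (auto elim!: oddE evenE)
  qed
  have "verts G \<subseteq> matching_word D es ` {1..2 * length es}"
  proof
    fix v assume "v \<in> verts G"
    then obtain e where e: "e \<in> M" "v \<in> ends G e"
      using M unfolding perfect_matching_def by blast
    then obtain i where i: "i < length es" "e = es ! i"
      using es(2) by (metis in_set_conv_nth)
    have "v = fst (D e) \<or> v = snd (D e)"
      using e D sub es(2) unfolding orientation_def by auto
    then show "v \<in> matching_word D es ` {1..2 * length es}"
    proof
      assume "v = fst (D e)"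
      then show ?thesis
        using i by (intro image_eqI[of _ _ "Suc (2 * i)"]) (auto simp: matching_word_tail)
    next
      assume "v = snd (D e)"
      then show ?thesis
        using i by (intro image_eqI[of _ _ "Suc (Suc (2 * i))"]) (auto simp: matching_word_head)
    qed
  qed
  then show ?thesis
    using inj vs unfolding bij_betw_def by blast
qed

lemma card_verts_matching:
  assumes "loopless_multigraph G" "perfect_matching G M" "orientation G D"
    "distinct es" "set es = M"
  shows "card (verts G) = 2 * length es"
  using bij_betw_same_card[OF matching_word_bij[OF assms]] by simp

lemma matching_perm_permutes:
  assumes "loopless_multigraph G" "vertex_enumeration G num" "perfect_matching G M"
    "orientation G D" "distinct es" "set es = M"
  shows "matching_perm num D es permutes {1..2 * length es}"
proof (rule bij_imp_permutes)
  have "bij_betw (num \<circ> matching_word D es) {1..2 * length es} {1..2 * length es}"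
    using matching_word_bij[OF assms(1,3-6)] assms(2) card_verts_matching[OF assms(1,3-6)]
    unfolding vertex_enumeration_def by (auto intro: bij_betw_trans)
  then show "bij_betw (matching_perm num D es) {1..2 * length es} {1..2 * length es}"
    by (rule iffD1[OF bij_betw_cong, rotated]) (simp add: matching_perm_word)
qed (simp only: matching_perm_word if_False)

lemmas matching_perm_permutation =
  permutes_imp_permutation[OF finite_atLeastAtMost matching_perm_permutes]

text \<open>Exchanging two edges of the listing exchanges their tails and exchanges their heads.\<close>

lemma sign_matching_perm_transpose:
  assumes "permutation (matching_perm num D es)" "a < length es" "b < length es"
  shows "sign (matching_perm num D (permute_list (transpose a b) es)) =
         sign (matching_perm num D es)"
proof -
  let ?t = "transpose (Suc (2 * a)) (Suc (2 * b))"
  let ?h = "transpose (Suc (Suc (2 * a))) (Suc (Suc (2 * b)))"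
  have p: "transpose a b permutes {..<length es}"
    using assms by (intro permutes_swap_id) auto
  have "matching_perm num D (permute_list (transpose a b) es) j =
        (matching_perm num D es \<circ> (?t \<circ> ?h)) j" for j
  proof (cases "j \<in> {1..2 * length es}")
    case True
    then show ?thesis
    proof (cases rule: position_cases)
      case (tail i)
      have "?h j = j" using tail by (intro transpose_apply_other) presburger+
      moreover have "?t j = Suc (2 * transpose a b i)"
        using tail by (auto simp: transpose_def)
      moreover have "transpose a b i < length es"
        using tail assms by (auto simp: transpose_def)
      ultimately show ?thesis
        using tail by (simp add: matching_perm_tail permute_list_nth[OF p])
    next
      case (head i)
      have "?h j = Suc (Suc (2 * transpose a b i))"
        using head by (auto simp: transpose_def)
      moreover have "?t (Suc (Suc (2 * transpose a b i))) = Suc (Suc (2 * transpose a b i))"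
        by (intro transpose_apply_other) presburger+
      moreover have "transpose a b i < length es"
        using head assms by (auto simp: transpose_def)
      ultimately show ?thesis
        using head by (simp add: matching_perm_head permute_list_nth[OF p])
    qed
  next
    case False
    then have "?h j = j" "?t j = j"
      using assms(2,3) by (auto intro!: transpose_apply_other)
    then show ?thesis
      using False by (auto simp: matching_perm_def)
  qed
  then have "matching_perm num D (permute_list (transpose a b) es) =
             matching_perm num D es \<circ> (?t \<circ> ?h)" by blast
  then show ?thesis
    using assms(1)
    by (simp add: sign_compose permutation_compose permutation_swap_id sign_swap_id)
qed

lemma sign_matching_perm_cong:
  assumes G: "loopless_multigraph G" "vertex_enumeration G num" "perfect_matching G M"
    "orientation G D" and es: "distinct es" "set es = M" and fs: "distinct fs" "set fs = M"
  shows "sign (matching_perm num D fs) = sign (matching_perm num D es)"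
proof -
  have "mset fs = mset es"
    using es fs set_eq_iff_mset_eq_distinct by blast
  then obtain p where p: "p permutes {..<length es}" "permute_list p es = fs"
    using mset_eq_permutation by blast
  have "sign (matching_perm num D (permute_list p es)) = sign (matching_perm num D es)"
    if "distinct es" "set es = M" "length es = n" "p permutes {..<n}" for n es
    using that(4) finite_lessThan that(1-3)
  proof (induction p arbitrary: es rule: permutes_induct)
    case id
    then show ?case by simp
  next
    case (swap a b p)
    have t: "transpose a b permutes {..<length es}"
      using swap by (intro permutes_swap_id) auto
    have "permute_list (transpose a b \<circ> p) es = permute_list p (permute_list (transpose a b) es)"
      using swap by (simp add: permute_list_compose)
    moreover have "sign (matching_perm num D (permute_list p (permute_list (transpose a b) es)))
        = sign (matching_perm num D (permute_list (transpose a b) es))"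
      using t swap.prems by (intro swap.IH) auto
    moreover have "sign (matching_perm num D (permute_list (transpose a b) es))
        = sign (matching_perm num D es)"
      using sign_matching_perm_transpose[OF matching_perm_permutation[OF G]] swap by simp
    ultimately show ?case by (simp only:)
  qed
  from this[OF es refl] p show ?thesis by simp
qed

text \<open>Hence the listing that underlies \<^const>\<open>matching_sign\<close> can be replaced by any other.\<close>

lemma matching_sign_eq:
  assumes "loopless_multigraph G" "vertex_enumeration G num" "perfect_matching G M"
    "orientation G D" "distinct es" "set es = M"
  shows "matching_sign num D M = sign (matching_perm num D es)"
proof -
  have "\<exists>fs. distinct fs \<and> set fs = M" using assms(5,6) by blast
  from someI_ex[OF this] show ?thesis
    unfolding matching_sign_def using sign_matching_perm_cong[OF assms] by blast
qed

lemma perfect_matching_listing: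
  assumes "loopless_multigraph G" "perfect_matching G M"
  obtains es where "distinct es" "set es = M"
  using assms finite_subset finite_distinct_list
  unfolding loopless_multigraph_def perfect_matching_def by metis

lemma matching_sign_square: "matching_sign num D M * matching_sign num D M = 1"
  by (simp add: matching_sign_def)

section \<open>Reversing edges\<close>

text \<open>The orientation obtained from \<open>D\<close> by reversing the edges in \<open>S\<close>.\<close>

definition reverse_edges :: "'e set \<Rightarrow> ('e \<Rightarrow> 'v \<times> 'v) \<Rightarrow> 'e \<Rightarrow> 'v \<times> 'v" where
  "reverse_edges S D e = (if e \<in> S then prod.swap (D e) else D e)"

text \<open>The sign \<open>(-1)\<^bsup>|M \<inter> S|\<^esup>\<close> for finite \<open>S\<close>; as a function of \<open>S\<close> it is a character of the group of edge
  sets under symmetric difference.\<close>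

definition edge_character :: "'e set \<Rightarrow> 'e set \<Rightarrow> int" where
  "edge_character M S = (\<Prod>e\<in>S. if e \<in> M then - 1 else 1)"

lemma orientation_reverse_edges: "orientation G D \<Longrightarrow> orientation G (reverse_edges S D)"
  unfolding orientation_def reverse_edges_def by (simp add: insert_commute)

lemma matching_sign_reverse_edge:
  assumes G: "loopless_multigraph G" "vertex_enumeration G num" "perfect_matching G M"
    and D: "orientation G D"
  shows "matching_sign num (reverse_edges {e} D) M =
         (if e \<in> M then - 1 else 1) * matching_sign num D M"
proof -
  obtain es where es: "distinct es" "set es = M"
    using perfect_matching_listing[OF G(1,3)] .
  note eq = matching_sign_eq[OF G D es]
    matching_sign_eq[OF G orientation_reverse_edges[OF D] es, of "{e}"]
  show ?thesis
  proof (cases "e \<in> M")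
    case True
    then obtain i where i: "i < length es" "es ! i = e"
      using es(2) by (metis in_set_conv_nth)
    let ?t = "transpose (Suc (2 * i)) (Suc (Suc (2 * i)))"
    have "matching_perm num (reverse_edges {e} D) es j = (matching_perm num D es \<circ> ?t) j" for j
    proof (cases "j \<in> {1..2 * length es}")
      case True
      then show ?thesis
      proof (cases rule: position_cases)
        case (tail l)
        show ?thesis
        proof (cases "l = i")
          case True
          then show ?thesis
            using tail i by (simp add: matching_perm_tail matching_perm_head reverse_edges_def)
        next
          case False
          then have "?t j = j" using tail by (intro transpose_apply_other) presburger+
          moreover have "es ! l \<noteq> e" using False tail i es(1) nth_eq_iff_index_eq by blast
          ultimately show ?thesis
            using tail by (simp add: matching_perm_tail reverse_edges_def)
        qed
      next
        case (head l)
        show ?thesis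
        proof (cases "l = i")
          case True
          then show ?thesis
            using head i by (simp add: matching_perm_tail matching_perm_head reverse_edges_def)
        next
          case False
          then have "?t j = j" using head by (intro transpose_apply_other) presburger+
          moreover have "es ! l \<noteq> e" using False head i es(1) nth_eq_iff_index_eq by blast
          ultimately show ?thesis
            using head by (simp add: matching_perm_head reverse_edges_def)
        qed
      qed
    next
      case False
      then have "?t j = j" using i by (auto intro!: transpose_apply_other)
      then show ?thesis using False by (auto simp: matching_perm_def)
    qed
    then have "matching_perm num (reverse_edges {e} D) es = matching_perm num D es \<circ> ?t"
      by blast
    then show ?thesis
      using True eq matching_perm_permutation[OF G D es]
      by (simp add: sign_compose permutation_swap_id sign_swap_id)
  next
    case False
    have "matching_perm num (reverse_edges {e} D) es = matching_perm num D es"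
    proof
      fix j
      have "es ! ((j - 1) div 2) \<noteq> e" if "j \<in> {1..2 * length es}"
      proof -
        have "(j - 1) div 2 < length es" using that by auto
        then show ?thesis using False es(2) nth_mem by blast
      qed
      then show "matching_perm num (reverse_edges {e} D) es j = matching_perm num D es j"
        unfolding matching_perm_def by (simp add: reverse_edges_def)
    qed
    then show ?thesis using False eq by simp
  qed
qed

lemma matching_sign_reverse_edges:
  assumes "loopless_multigraph G" "vertex_enumeration G num" "perfect_matching G M"
    and "orientation G D" "finite S"
  shows "matching_sign num (reverse_edges S D) M = edge_character M S * matching_sign num D M"
  using \<open>finite S\<close>
proof induction
  case empty
  then show ?case by (simp add: reverse_edges_def edge_character_def)
next
  case (insert e S)
  then have "reverse_edges (insert e S) D = reverse_edges {e} (reverse_edges S D)"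
    by (auto simp: reverse_edges_def)
  then show ?case
    using insert matching_sign_reverse_edge[OF assms(1-3) orientation_reverse_edges[OF assms(4)]]
    by (simp add: edge_character_def)
qed

section \<open>Existence of pfaffian families of orientations\<close>

lemma edge_character_orthogonal:
  assumes "finite E" "M \<subseteq> E" "N \<subseteq> E"
  shows "(\<Sum>S\<in>Pow E. edge_character M S * edge_character N S) =
         (if M = N then 2 ^ card E else 0)"
proof -
  let ?c = "\<lambda>e. (if e \<in> M then - 1 else 1) * (if e \<in> N then - 1 else (1::int))"
  have "(\<Sum>S\<in>Pow E. edge_character M S * edge_character N S) = (\<Sum>S\<in>Pow E. prod ?c S)"
    unfolding edge_character_def by (simp only: prod.distrib)
  also have "\<dots> = (\<Prod>e\<in>E. ?c e + 1)"
    using prod_add[OF assms(1), of ?c "\<lambda>_. 1"] by (simp only: prod.neutral_const mult_1_right)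
  also have "\<dots> = (if M = N then 2 ^ card E else 0)"
  proof (cases "M = N")
    case True
    then have "(\<Prod>e\<in>E. ?c e + 1) = (\<Prod>e\<in>E. 2)" by (intro prod.cong) auto
    then show ?thesis using True by simp
  next
    case False
    then obtain e where "e \<in> M \<longleftrightarrow> e \<notin> N" by blast
    then have "e \<in> E" "?c e + 1 = 0" using assms(2,3) by auto
    then show ?thesis using False assms(1) by (metis (mono_tags, lifting) prod_zero)
  qed
  finally show ?thesis .
qed

lemma vertex_enumeration_exists:
  "loopless_multigraph G \<Longrightarrow> \<exists>num. vertex_enumeration G num"
  unfolding vertex_enumeration_def loopless_multigraph_def
  using ex_bij_betw_finite_nat[of "verts G"] ex_bij_betw_nat_finite_1[of "verts G"]
  by (meson bij_betw_inv_into)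

lemma orientation_exists:
  assumes "loopless_multigraph G" shows "\<exists>D. orientation G D"
proof -
  have "\<exists>p. {fst p, snd p} = ends G e" if "e \<in> edges G" for e
  proof -
    have "card (ends G e) = 2" using assms that unfolding loopless_multigraph_def by blast
    then show ?thesis by (metis card_2_iff fst_conv snd_conv)
  qed
  then show ?thesis unfolding orientation_def by metis
qed

text \<open>All \<open>2\<^bsup>|E|\<^esup>\<close> reversals of one orientation form a pfaffian family: up to the signs of the
  rows, its signature matrix consists of distinct characters, so its rows are orthogonal.\<close>

lemma k_pfaffian_exists:
  assumes G: "loopless_multigraph G"
  shows "\<exists>k>0. k_pfaffian G k"
proof -
  obtain num where num: "vertex_enumeration G num" using vertex_enumeration_exists[OF G] by blast
  obtain D where D: "orientation G D" using orientation_exists[OF G] by blast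
  let ?E = "edges G" and ?P = "Collect (perfect_matching G)"
  have fin: "finite ?E" using G unfolding loopless_multigraph_def by simp
  have sub: "M \<subseteq> ?E" if "M \<in> ?P" for M using that unfolding perfect_matching_def by simp
  have finP: "finite ?P" using sub fin by (meson PowI finite_Pow_iff finite_subset subsetI)
  let ?k = "card (Pow ?E)"
  obtain g where g: "bij_betw g {1..?k} (Pow ?E)"
    using ex_bij_betw_nat_finite_1 fin by blast
  define s where "s M = real_of_int (matching_sign num D M)" for M
  define c where "c M S = real_of_int (edge_character M S)" for M S :: "'b set"
  define x where "x S = (\<Sum>N\<in>?P. s N * c N S) / 2 ^ card ?E" for S
  have ss: "s M * s M = 1" for M
    unfolding s_def using matching_sign_square by (metis of_int_1 of_int_mult)
  have orth: "(\<Sum>S\<in>Pow ?E. c M S * c N S) = (if M = N then 2 ^ card ?E else 0)"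
    if "M \<in> ?P" "N \<in> ?P" for M N
    using arg_cong[OF edge_character_orthogonal[OF fin sub[OF that(1)] sub[OF that(2)]],
        of real_of_int]
    unfolding c_def by simp
  have "(\<Sum>i = 1..?k. signature_matrix num (\<lambda>i. reverse_edges (g i) D) M i * x (g i)) = 1"
    if M: "perfect_matching G M" for M
  proof -
    have "(\<Sum>i = 1..?k. signature_matrix num (\<lambda>i. reverse_edges (g i) D) M i * x (g i))
        = (\<Sum>i = 1..?k. c M (g i) * s M * x (g i))"
    proof (intro sum.cong refl)
      fix i assume "i \<in> {1..?k}"
      then have "g i \<subseteq> ?E" using bij_betwE[OF g] by blast
      then have "finite (g i)" using fin finite_subset by blast
      then show "signature_matrix num (\<lambda>i. reverse_edges (g i) D) M i * x (g i)
          = c M (g i) * s M * x (g i)"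
        unfolding signature_matrix_def c_def s_def
        using matching_sign_reverse_edges[OF G num M D] by simp
    qed
    also have "\<dots> = (\<Sum>S\<in>Pow ?E. c M S * s M * x S)"
      by (rule sum.reindex_bij_betw[OF g])
    also have "\<dots> = (\<Sum>S\<in>Pow ?E. \<Sum>N\<in>?P. s M * s N * (c M S * c N S) / 2 ^ card ?E)"
      unfolding x_def by (simp add: sum_distrib_left sum_divide_distrib mult_ac)
    also have "\<dots> = (\<Sum>N\<in>?P. \<Sum>S\<in>Pow ?E. s M * s N * (c M S * c N S) / 2 ^ card ?E)"
      by (rule sum.swap)
    also have "\<dots> = (\<Sum>N\<in>?P. s M * s N * (\<Sum>S\<in>Pow ?E. c M S * c N S) / 2 ^ card ?E)"
      by (simp only: sum_distrib_left sum_divide_distrib)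
    also have "\<dots> = (\<Sum>N\<in>?P. if M = N then s M * s N else 0)"
      using M orth by (intro sum.cong) auto
    also have "\<dots> = 1"
      using finP M ss by (simp add: sum.delta')
    finally show ?thesis .
  qed
  then have "pfaffian_k_orientation G num ?k (\<lambda>i. reverse_edges (g i) D)"
    using orientation_reverse_edges[OF D]
    unfolding pfaffian_k_orientation_def k_orientation_def
    by (intro conjI ballI exI[of _ "\<lambda>i. x (g i)"]) auto
  moreover have "?k > 0" using fin by (simp add: card_Pow)
  ultimately show ?thesis using num unfolding k_pfaffian_def by blast
qed

section \<open>Contractions of a cut\<close>

lemma None_in_ends_contract:
  "None \<in> ends (contract G X) e \<longleftrightarrow> ends G e \<inter> X \<noteq> {}"
  by (auto simp: contract_def contraction_map_def split: if_splits)

lemma Some_in_ends_contract: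
  "Some v \<in> ends (contract G X) e \<longleftrightarrow> v \<in> ends G e \<and> v \<notin> X"
  by (auto simp: contract_def contraction_map_def split: if_splits)

lemma edges_contract: "edges (contract G X) = {e \<in> edges G. \<not> ends G e \<subseteq> X}"
  by (simp add: contract_def)

lemma None_in_verts_contract: "None \<in> verts (contract G X) \<longleftrightarrow> verts G \<inter> X \<noteq> {}"
  by (auto simp: contract_def contraction_map_def split: if_splits)

lemma Some_in_verts_contract: "Some v \<in> verts (contract G X) \<longleftrightarrow> v \<in> verts G - X"
  by (auto simp: contract_def contraction_map_def split: if_splits)

lemma contraction_map_eq:
  "contraction_map X u = contraction_map X v \<longleftrightarrow> u = v \<or> u \<in> X \<and> v \<in> X"
  by (auto simp: contraction_map_def)

lemma loopless_ends:
  assumes "loopless_multigraph G" "e \<in> edges G"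
  obtains u v where "ends G e = {u, v}" "u \<noteq> v" "u \<in> verts G" "v \<in> verts G"
  using assms unfolding loopless_multigraph_def by (metis card_2_iff insert_subset)

lemma loopless_contract:
  assumes "loopless_multigraph G"
  shows "loopless_multigraph (contract G X)"
proof -
  have "ends (contract G X) e \<subseteq> verts (contract G X) \<and> card (ends (contract G X) e) = 2"
    if "e \<in> edges (contract G X)" for e
  proof -
    have e: "e \<in> edges G" "\<not> ends G e \<subseteq> X" using that by (auto simp: edges_contract)
    obtain u v where uv: "ends G e = {u, v}" "u \<noteq> v" "u \<in> verts G" "v \<in> verts G"
      using loopless_ends[OF assms e(1)] .
    then have "contraction_map X u \<noteq> contraction_map X v"
      using e(2) by (auto simp: contraction_map_eq)
    then show ?thesis using uv by (simp add: contract_def)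
  qed
  moreover have "finite (verts (contract G X))" "finite (edges (contract G X))"
    using assms by (simp_all add: loopless_multigraph_def contract_def)
  ultimately show ?thesis unfolding loopless_multigraph_def by blast
qed

text \<open>The orientation that \<open>D\<close> induces on the contraction.\<close>

definition contract_orientation ::
    "'v set \<Rightarrow> ('e \<Rightarrow> 'v \<times> 'v) \<Rightarrow> 'e \<Rightarrow> 'v option \<times> 'v option" where
  "contract_orientation X D e = map_prod (contraction_map X) (contraction_map X) (D e)"

lemma orientation_contract:
  assumes "orientation G D"
  shows "orientation (contract G X) (contract_orientation X D)"
  unfolding orientation_def
proof
  fix e assume "e \<in> edges (contract G X)"
  then have "ends G e = {fst (D e), snd (D e)}"
    using assms unfolding orientation_def edges_contract by auto
  then show "{fst (contract_orientation X D e), snd (contract_orientation X D e)}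
      = ends (contract G X) e"
    by (simp add: contract_def contract_orientation_def)
qed

lemma matching_word_contract:
  "matching_word (contract_orientation X D) es j = contraction_map X (matching_word D es j)"
  by (simp add: matching_word_def contract_orientation_def)

lemma cut_complement: "X \<subseteq> verts G \<Longrightarrow> cut G (verts G - X) = cut G X"
  unfolding cut_def by (auto simp: double_diff)

lemma cut_subset_edges_contract: "cut G X \<subseteq> edges (contract G X)"
  by (auto simp: cut_def edges_contract)

lemma cut_iff_contract:
  assumes "loopless_multigraph G" "e \<in> edges (contract G X)"
  shows "e \<in> cut G X \<longleftrightarrow> None \<in> ends (contract G X) e"
  using assms unfolding None_in_ends_contract
  by (auto simp: cut_def edges_contract loopless_multigraph_def)

text \<open>A perfect matching of a contraction meets the cut in exactly one edge, the one that
  covers the contracted vertex.\<close>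

lemma matching_contract_cut_edge:
  assumes "loopless_multigraph G" "X \<subseteq> verts G" "X \<noteq> {}" "perfect_matching (contract G X) M"
  obtains e where "e \<in> cut G X" "M \<inter> cut G X = {e}"
proof -
  have "None \<in> verts (contract G X)" using assms(2,3) by (auto simp: None_in_verts_contract)
  then have "\<exists>!e. e \<in> M \<and> None \<in> ends (contract G X) e"
    using assms(4) unfolding perfect_matching_def by blast
  moreover have "M \<subseteq> edges (contract G X)"
    using assms(4) unfolding perfect_matching_def by blast
  ultimately have "\<exists>!e. e \<in> M \<and> e \<in> cut G X"
    using cut_iff_contract[OF assms(1)] by (metis subsetD)
  then show ?thesis using that by blast
qed

lemma matching_union_covers:
  assumes G: "loopless_multigraph G" and "perfect_matching (contract G X) M" "e \<in> M"
    and "N \<subseteq> {f \<in> edges G. \<not> ends G f \<subseteq> verts G - X}" "N \<inter> cut G X = {e}"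
    and "v \<in> verts G - X"
  shows "\<exists>!f. f \<in> M \<union> N \<and> v \<in> ends G f"
proof -
  have "Some v \<in> verts (contract G X)"
    using assms(6) by (simp only: Some_in_verts_contract)
  with assms(2) have "\<exists>!f. f \<in> M \<and> Some v \<in> ends (contract G X) f"
    unfolding perfect_matching_def by (elim conjE bspec)
  then have "\<exists>!f. f \<in> M \<and> v \<in> ends G f"
    using assms(6) by (simp add: Some_in_ends_contract)
  moreover have "f = e" if "f \<in> N" "v \<in> ends G f" for f
  proof -
    have f: "f \<in> edges G" "\<not> ends G f \<subseteq> verts G - X" using that(1) assms(4) by auto
    then have "ends G f \<subseteq> verts G" using G unfolding loopless_multigraph_def by blast
    then have "f \<in> cut G X" using f that(2) assms(6) unfolding cut_def by blast
    then show ?thesis using that(1) assms(5) by blast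
  qed
  ultimately show ?thesis using assms(3) by blast
qed

lemma matching_union:
  assumes G: "loopless_multigraph G" and X: "X \<subseteq> verts G" and e: "e \<in> cut G X"
    and M: "perfect_matching (contract G X) M" "e \<in> M"
    and N: "perfect_matching (contract G (verts G - X)) N" "e \<in> N"
  shows "perfect_matching G (M \<union> N)" and "M \<inter> N = {e}"
proof -
  let ?Y = "verts G - X"
  have ne: "X \<noteq> {}" "?Y \<noteq> {}" using e by (auto simp: cut_def)
  obtain e1 where "M \<inter> cut G X = {e1}"
    using matching_contract_cut_edge[OF G X ne(1) M(1)] .
  then have MC: "M \<inter> cut G X = {e}" using M(2) e by auto
  obtain e2 where "N \<inter> cut G ?Y = {e2}"
    using matching_contract_cut_edge[OF G Diff_subset ne(2) N(1)] .
  then have NC: "N \<inter> cut G X = {e}" using N(2) e unfolding cut_complement[OF X] by auto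
  have Ms: "M \<subseteq> {f \<in> edges G. \<not> ends G f \<subseteq> X}"
    and Ns: "N \<subseteq> {f \<in> edges G. \<not> ends G f \<subseteq> ?Y}"
    using M(1) N(1) unfolding perfect_matching_def edges_contract by auto
  have "M \<inter> N \<subseteq> cut G X"
    using Ms Ns G unfolding cut_def loopless_multigraph_def by blast
  then show "M \<inter> N = {e}" using MC M(2) N(2) by blast
  have "\<exists>!f. f \<in> M \<union> N \<and> v \<in> ends G f" if "v \<in> verts G" for v
  proof (cases "v \<in> X")
    case True
    then have "\<exists>!f. f \<in> N \<union> M \<and> v \<in> ends G f"
      using that X MC cut_complement[OF X] Ms double_diff[OF X subset_refl]
      by (intro matching_union_covers[OF G N]) auto
    then show ?thesis by (simp add: Un_commute)
  next
    case False
    then show ?thesis using that NC Ns by (intro matching_union_covers[OF G M]) auto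
  qed
  then show "perfect_matching G (M \<union> N)"
    using Ms Ns unfolding perfect_matching_def by blast
qed

text \<open>The heart of the argument. Let \<open>M\<^sub>1\<close> and \<open>M\<^sub>2\<close> be perfect matchings of the contraction that
  contain the cut edge \<open>e\<close>. With \<open>e\<close> listed first, the words of \<open>M\<^sub>1\<close> and \<open>M\<^sub>2\<close> differ by a
  permutation of positions that fixes the position of the contracted vertex. Hence the words
  of the extended matchings \<open>M\<^sub>1 \<union> N\<close> and \<open>M\<^sub>2 \<union> N\<close> differ by the same permutation, and the two
  signs change by the same factor.\<close>

lemma matching_sign_contract_ratio:
  assumes G: "loopless_multigraph G" and X: "X \<subseteq> verts G" and e: "e \<in> cut G X"
    and num: "vertex_enumeration G num" "vertex_enumeration (contract G X) num'"
    and D: "orientation G D"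
    and M1: "perfect_matching (contract G X) M1" "e \<in> M1"
    and M2: "perfect_matching (contract G X) M2" "e \<in> M2"
    and N: "perfect_matching (contract G (verts G - X)) N" "e \<in> N"
  shows "matching_sign num D (M1 \<union> N) * matching_sign num' (contract_orientation X D) M1 =
         matching_sign num D (M2 \<union> N) * matching_sign num' (contract_orientation X D) M2"
proof -
  let ?H = "contract G X" and ?D = "contract_orientation X D"
  note H = loopless_contract[OF G, of X] and oH = orientation_contract[OF D, of X]
  have listing: "\<exists>es. distinct (a # es) \<and> set (a # es) = A" if "a \<in> A" "finite A" for a :: 'b and A
    using that finite_distinct_list[of "A - {a}"] by (auto intro: exI)
  have fin: "finite A" if "perfect_matching (contract G Y) A" for A Y
    using loopless_contract[OF G, of Y] that finite_subset
    unfolding loopless_multigraph_def perfect_matching_def by blast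
  obtain es1 where es1: "distinct (e # es1)" "set (e # es1) = M1"
    using listing[OF M1(2) fin[OF M1(1)]] by blast
  obtain es2 where es2: "distinct (e # es2)" "set (e # es2) = M2"
    using listing[OF M2(2) fin[OF M2(1)]] by blast
  obtain fs where fs: "distinct (e # fs)" "set (e # fs) = N"
    using listing[OF N(2) fin[OF N(1)]] by blast
  let ?l1 = "e # es1" and ?l2 = "e # es2"
  have len: "length ?l2 = length ?l1"
    using card_verts_matching[OF H M1(1) oH es1] card_verts_matching[OF H M2(1) oH es2] by simp
  note U1 = matching_union[OF G X e M1 N] and U2 = matching_union[OF G X e M2 N]
  have u1: "distinct (?l1 @ fs)" "set (?l1 @ fs) = M1 \<union> N"
    using es1 fs U1(2) by auto
  have u2: "distinct (?l2 @ fs)" "set (?l2 @ fs) = M2 \<union> N"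
    using es2 fs U2(2) by auto
  let ?I = "{1..2 * length ?l1}"
  let ?p1 = "matching_perm num' ?D ?l1" and ?p2 = "matching_perm num' ?D ?l2"
  let ?q1 = "matching_perm num D (?l1 @ fs)" and ?q2 = "matching_perm num D (?l2 @ fs)"
  have p1: "?p1 permutes ?I" by (rule matching_perm_permutes[OF H num(2) M1(1) oH es1])
  have p2: "?p2 permutes ?I" using matching_perm_permutes[OF H num(2) M2(1) oH es2] len by simp
  define \<sigma> where "\<sigma> = inv ?p1 \<circ> ?p2"
  have \<sigma>: "\<sigma> permutes ?I"
    unfolding \<sigma>_def by (rule permutes_compose[OF p2 permutes_inv[OF p1]])
  have p\<sigma>: "?p2 = ?p1 \<circ> \<sigma>"
    unfolding \<sigma>_def using permutes_inv_o(1)[OF p1] by (simp add: o_assoc)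
  \<comment> \<open>The position of the contracted vertex, which is an end of the common first edge.\<close>
  define t :: nat where "t = (if fst (D e) \<in> X then 1 else 2)"
  have w1: "bij_betw (matching_word ?D ?l1) ?I (verts ?H)"
    by (rule matching_word_bij[OF H M1(1) oH es1])
  have w2: "bij_betw (matching_word ?D ?l2) ?I (verts ?H)"
    using matching_word_bij[OF H M2(1) oH es2] len by simp
  have t: "t \<in> ?I" by (auto simp: t_def)
  have wt: "matching_word D ?l1 t = matching_word D ?l2 t"
    by (auto simp: t_def matching_word_def)
  have "{fst (D e), snd (D e)} \<inter> X \<noteq> {}"
    using e D unfolding cut_def orientation_def by auto
  then have tX: "matching_word D ?l1 t \<in> X"
    by (auto simp: t_def matching_word_def)
  have word: "matching_word D ?l2 j = matching_word D ?l1 (\<sigma> j)" if j: "j \<in> ?I" for j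
  proof -
    have i: "\<sigma> j \<in> ?I" using \<sigma> j by (simp only: permutes_in_image)
    have "num' (matching_word ?D ?l2 j) = num' (matching_word ?D ?l1 (\<sigma> j))"
      using fun_cong[OF p\<sigma>, of j] i j len unfolding matching_perm_word by simp
    then have eq: "matching_word ?D ?l2 j = matching_word ?D ?l1 (\<sigma> j)"
      using num(2) bij_betwE[OF w1] bij_betwE[OF w2] i j
      unfolding vertex_enumeration_def by (metis bij_betw_imp_inj_on inj_onD)
    show ?thesis
    proof (cases "matching_word D ?l2 j \<in> X")
      case True
      then have "matching_word ?D ?l2 j = matching_word ?D ?l2 t"
        "matching_word ?D ?l1 (\<sigma> j) = matching_word ?D ?l1 t"
        using eq tX wt by (auto simp: matching_word_contract contraction_map_def split: if_splits)
      then have "j = t" "\<sigma> j = t"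
        using w1 w2 i j t by (meson bij_betw_imp_inj_on inj_onD)+
      then show ?thesis using wt by simp
    next
      case False
      then show ?thesis using eq by (simp add: matching_word_contract contraction_map_eq)
    qed
  qed
  have "?q2 j = (?q1 \<circ> \<sigma>) j" for j
  proof (cases "j \<in> ?I")
    case True
    have app: "matching_word D (l @ fs) i = matching_word D l i"
      if "i \<in> ?I" "length l = length ?l1" for i l
      using that unfolding matching_word_def by (auto simp: nth_append)
    have i: "\<sigma> j \<in> ?I" using \<sigma> True by (simp only: permutes_in_image)
    have "?q2 j = num (matching_word D ?l2 j)"
      using app[OF True len] True len by (auto simp: matching_perm_word)
    moreover have "?q1 (\<sigma> j) = num (matching_word D ?l1 (\<sigma> j))"
      using app[OF i refl] i by (auto simp: matching_perm_word)
    ultimately show ?thesis using word[OF True] by simp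
  next
    case False
    then have "\<sigma> j = j" using \<sigma> by (rule permutes_not_in[rotated])
    moreover have "(?l2 @ fs) ! ((j - 1) div 2) = (?l1 @ fs) ! ((j - 1) div 2)" if "j \<noteq> 0"
    proof -
      have "\<not> (j - 1) div 2 < length ?l1" using False that by auto
      then show ?thesis using len by (simp only: nth_append if_False)
    qed
    ultimately show ?thesis using len by (auto simp: matching_perm_def)
  qed
  then have q\<sigma>: "?q2 = ?q1 \<circ> \<sigma>" by blast
  have perm: "permutation ?p1" "permutation ?q1" "permutation \<sigma>"
    using matching_perm_permutation[OF H num(2) M1(1) oH es1]
      matching_perm_permutation[OF G num(1) U1(1) D u1] permutes_imp_permutation[OF _ \<sigma>] by simp_all
  have "matching_sign num D (M2 \<union> N) * matching_sign num' ?D M2 = sign ?q2 * sign ?p2"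
    using matching_sign_eq[OF H num(2) M2(1) oH es2] matching_sign_eq[OF G num(1) U2(1) D u2]
    by (simp only:)
  also have "\<dots> = (sign ?q1 * sign \<sigma>) * (sign ?p1 * sign \<sigma>)"
    unfolding p\<sigma> q\<sigma> using perm by (simp only: sign_compose)
  also have "\<dots> = sign ?q1 * sign ?p1 * (sign \<sigma> * sign \<sigma>)"
    by (simp only: mult_ac)
  also have "\<dots> = sign ?q1 * sign ?p1"
    by (simp only: sign_idempotent mult_1_right)
  also have "\<dots> = matching_sign num D (M1 \<union> N) * matching_sign num' ?D M1"
    using matching_sign_eq[OF H num(2) M1(1) oH es1] matching_sign_eq[OF G num(1) U1(1) D u1]
    by (simp only:)
  finally show ?thesis by simp
qed

section \<open>Pfaffian numbers of the contractions\<close>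

lemma k_pfaffian_contract:
  assumes G: "loopless_multigraph G" and X: "X \<subseteq> verts G" "X \<noteq> {}"
    and ext: "\<And>e. e \<in> cut G X \<Longrightarrow> \<exists>N. perfect_matching (contract G (verts G - X)) N \<and> e \<in> N"
    and k: "k_pfaffian G k"
  shows "k_pfaffian (contract G X) k"
proof -
  let ?H = "contract G X" and ?C = "cut G X"
  note H = loopless_contract[OF G, of X]
  obtain num Ds x where num: "vertex_enumeration G num"
    and Ds: "\<And>i. i \<in> {1..k} \<Longrightarrow> orientation G (Ds i)"
    and x: "\<And>M. perfect_matching G M \<Longrightarrow> (\<Sum>i = 1..k. signature_matrix num Ds M i * x i) = 1"
    using k unfolding k_pfaffian_def pfaffian_k_orientation_def k_orientation_def by blast
  obtain num' where num': "vertex_enumeration ?H num'" using vertex_enumeration_exists[OF H] by blast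
  obtain N where N: "\<And>e. e \<in> ?C \<Longrightarrow> perfect_matching (contract G (verts G - X)) (N e)"
    "\<And>e. e \<in> ?C \<Longrightarrow> e \<in> N e"
    using ext by metis
  \<comment> \<open>For a perfect matching \<open>M\<close> that contains \<open>e\<close> the factor below depends on \<open>e\<close> only, so it can
    be corrected by reversing \<open>e\<close>.\<close>
  define r where "r i e M = matching_sign num (Ds i) (M \<union> N e) *
      matching_sign num' (contract_orientation X (Ds i)) M" for i e M
  define S where "S i = {e \<in> ?C. \<exists>M. perfect_matching ?H M \<and> e \<in> M \<and> r i e M = - 1}" for i
  define Ds' where "Ds' i = reverse_edges (S i) (contract_orientation X (Ds i))" for i
  have finS: "finite (S i)" for i
    using G unfolding S_def cut_def loopless_multigraph_def by simp
  have sgn: "matching_sign num' (Ds' i) M = matching_sign num (Ds i) (M \<union> N e)"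
    if i: "i \<in> {1..k}" and M: "perfect_matching ?H M" and e: "e \<in> ?C" "M \<inter> ?C = {e}" for i M e
  proof -
    let ?s = "matching_sign num' (contract_orientation X (Ds i)) M"
    have eM: "e \<in> M" using e by blast
    have r: "r i e M' = r i e M" if "perfect_matching ?H M'" "e \<in> M'" for M'
      unfolding r_def
      by (rule matching_sign_contract_ratio[OF G X(1) e(1) num num' Ds[OF i] that M eM N[OF e(1)]])
    have mem: "e \<in> S i \<longleftrightarrow> r i e M = - 1"
    proof
      assume "e \<in> S i"
      then obtain M' where "perfect_matching ?H M'" "e \<in> M'" "r i e M' = - 1"
        unfolding S_def by blast
      then show "r i e M = - 1" by (metis r)
    next
      assume "r i e M = - 1"
      then show "e \<in> S i" unfolding S_def using e(1) M eM by blast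
    qed
    have "edge_character M (S i) = (\<Prod>f\<in>S i. if f = e then - 1 else 1)"
      unfolding edge_character_def using e by (intro prod.cong) (auto simp: S_def)
    also have "\<dots> = (if e \<in> S i then - 1 else 1)" using finS by (simp add: prod.delta)
    also have "\<dots> = r i e M"
    proof -
      have "r i e M = 1 \<or> r i e M = - 1"
        unfolding r_def matching_sign_def by (simp add: sign_def)
      then show ?thesis using mem by auto
    qed
    finally have "matching_sign num' (Ds' i) M = r i e M * ?s"
      unfolding Ds'_def
      using matching_sign_reverse_edges[OF H num' M orientation_contract[OF Ds[OF i]] finS] by simp
    then show ?thesis
      unfolding r_def using matching_sign_square by (metis mult.assoc mult_1_right)
  qed
  have "(\<Sum>i = 1..k. signature_matrix num' Ds' M i * x i) = 1" if M: "perfect_matching ?H M" for M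
  proof -
    obtain e where e: "e \<in> ?C" "M \<inter> ?C = {e}" using matching_contract_cut_edge[OF G X M] .
    then have "perfect_matching G (M \<union> N e)"
      using matching_union(1)[OF G X(1) e(1) M _ N[OF e(1)]] by blast
    moreover have "signature_matrix num' Ds' M i = signature_matrix num Ds (M \<union> N e) i"
      if "i \<in> {1..k}" for i
      unfolding signature_matrix_def using sgn[OF that M e] by simp
    ultimately show ?thesis using x[of "M \<union> N e"] by simp
  qed
  then have "pfaffian_k_orientation ?H num' k Ds'"
    unfolding pfaffian_k_orientation_def k_orientation_def Ds'_def
    using orientation_reverse_edges[OF orientation_contract[OF Ds]] by blast
  then show ?thesis unfolding k_pfaffian_def using num' by blast
qed

lemma pf_contract_le:
  assumes G: "loopless_multigraph G" and "X \<subseteq> verts G" "X \<noteq> {}"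
    and mc: "matching_covered (contract G (verts G - X))"
  shows "pf (contract G X) \<le> pf G"
proof -
  have "0 < pf G \<and> k_pfaffian G (pf G)"
    unfolding pf_def by (rule LeastI_ex[OF k_pfaffian_exists[OF G]])
  moreover have "\<exists>N. perfect_matching (contract G (verts G - X)) N \<and> e \<in> N" if "e \<in> cut G X" for e
  proof -
    have "e \<in> edges (contract G (verts G - X))"
      using that cut_subset_edges_contract[of G "verts G - X"]
      unfolding cut_complement[OF assms(2)] by (rule subsetD[rotated])
    then show ?thesis using mc unfolding matching_covered_def by (elim conjE bspec)
  qed
  ultimately have "0 < pf G \<and> k_pfaffian (contract G X) (pf G)"
    using k_pfaffian_contract[OF assms(1-3)] by blast
  then show ?thesis unfolding pf_def[of "contract G X"] by (rule Least_le)
qed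

text \<open>Two shores of one cut agree or are complementary: the vertices that lie in exactly one of
  them form a set that no edge leaves. So the contractions of \<open>X\<close> and of its complement are
  matching covered, whichever shore witnesses that the cut is separating.\<close>

lemma cut_shore_unique:
  assumes G: "loopless_multigraph G" "connected_graph G"
    and "X \<subseteq> verts G" "Y \<subseteq> verts G" and eq: "cut G X = cut G Y"
  shows "X = Y \<or> X = verts G - Y"
proof -
  have step: "(u \<in> X \<longleftrightarrow> u \<in> Y) \<longleftrightarrow> (v \<in> X \<longleftrightarrow> v \<in> Y)" if uv: "(u, v) \<in> adjacency G" for u v
  proof -
    obtain e where e: "e \<in> edges G" "ends G e = {u, v}" using uv by (auto simp: adjacency_def)
    then have "u \<in> verts G" "v \<in> verts G" using G(1) by (auto simp: loopless_multigraph_def)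
    then have "e \<in> cut G Z \<longleftrightarrow> (u \<in> Z) \<noteq> (v \<in> Z)" for Z
      using e by (auto simp: cut_def)
    then show ?thesis using eq by blast
  qed
  have const: "(u \<in> X \<longleftrightarrow> u \<in> Y) \<longleftrightarrow> (v \<in> X \<longleftrightarrow> v \<in> Y)" if "(u, v) \<in> (adjacency G)\<^sup>*" for u v
    using that by induction (use step in blast)+
  obtain r where r: "r \<in> verts G" using G(2) by (auto simp: connected_graph_def)
  have "(r \<in> X \<longleftrightarrow> r \<in> Y) \<longleftrightarrow> (v \<in> X \<longleftrightarrow> v \<in> Y)" if "v \<in> verts G" for v
    using const G(2) r that unfolding connected_graph_def by blast
  then show ?thesis using assms(3,4) by blast
qed

theorem corollary28:
  fixes G :: "('v, 'e) mgraph" and X :: "'v set" and C :: "'e set"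
  assumes "simple_graph G"
    and "matching_covered G"
    and "X \<subseteq> verts G"
    and "C = cut G X"
    and "separating_cut G C"
  shows "pf G \<ge> max (pf (contract G X)) (pf (contract G (verts G - X)))"
proof -
  have G: "loopless_multigraph G" "connected_graph G"
    using assms(1,2) by (auto simp: simple_graph_def matching_covered_def)
  obtain Y where Y: "Y \<subseteq> verts G" "Y \<noteq> {}" "verts G - Y \<noteq> {}" "cut G X = cut G Y"
    "matching_covered (contract G Y)" "matching_covered (contract G (verts G - Y))"
    using assms(4,5) unfolding separating_cut_def by blast
  have "X = Y \<or> X = verts G - Y"
    by (rule cut_shore_unique[OF G assms(3) Y(1,4)])
  then have X: "X \<noteq> {}" "verts G - X \<noteq> {}" "matching_covered (contract G X)"
    "matching_covered (contract G (verts G - X))"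
    using Y by (auto simp: double_diff)
  have "pf (contract G X) \<le> pf G"
    by (rule pf_contract_le[OF G(1) assms(3) X(1,4)])
  moreover have "pf (contract G (verts G - X)) \<le> pf G"
    using X(2,3) assms(3) by (intro pf_contract_le[OF G(1)]) (auto simp: double_diff)
  ultimately show ?thesis by simp
qed

end
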